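(* Let $\delta\in(0,1]$ and suppose the number of experiments satisfies $N\geq 32\log(2/\delta)$. Then with probability at least $1-\delta$, the error $e_N=\hat a-a$ of the least-squares estimate satisfies $$|e_N|\leq 4\,\frac{\sigma_w}{\sigma_x}\sqrt{\frac{\log(4/\delta)}{N}}.$$
   Context: Let $a\in\mathbb{R}$, $\sigma_w,\sigma_u>0$, and let $T\ge1$ be an integer. Consider $N$ independent experiments $i=1,\dots,N$ on the scalar system $$x^{(i)}_{t+1}=a x^{(i)}_t+u^{(i)}_t+w^{(i)}_t,\qquad x^{(i)}_0=0,\qquad t=0,\dots,T,$$ where all $w^{(i)}_t\sim\mathcal{N}(0,\sigma_w^2)$ and $u^{(i)}_t\sim\mathcal{N}(0,\sigma_u^2)$ are mutually independent over $i$ and $t$ and of each other. The estimate of $a$ uses only the last transition of each experiment: $$\hat a=\arg\min_{a'\in\mathbb{R}}\sum_{i=1}^N\big(x^{(i)}_{T+1}-a'x^{(i)}_T-u^{(i)}_T\big)^2,\qquad e_N:=\hat a-a=\frac{\sum_{i=1}^N x^{(i)}_Tw^{(i)}_T}{\sum_{i=1}^N (x^{(i)}_T)^2}.$$ Define $\sigma_x^2:=(\sigma_w^2+\sigma_u^2)\sum_{t=0}^{T-1}a^{2t}$ with $\sigma_x>0$, the variance of $x^{(i)}_T$. $\log$ is the natural logarithm. *)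

theory Defs
  imports "HOL-Probability.Probability"
begin

text \<open>
  The trajectories are indexed by experiment and time, so \<open>x i t\<close> and \<open>u i t\<close> are the state and
  the input of experiment \<open>i\<close> at time \<open>t\<close>. If some \<open>x i T\<close> with \<open>1 \<le> i \<le> N\<close> is nonzero, the loss has
  exactly one minimizer. Otherwise the loss does not depend on \<open>a'\<close>, and \<^const>\<open>arg_min\<close>
  returns a real number that is the same for all such data.
\<close>

definition ls_estimate ::
  "nat \<Rightarrow> nat \<Rightarrow> (nat \<Rightarrow> nat \<Rightarrow> real) \<Rightarrow> (nat \<Rightarrow> nat \<Rightarrow> real) \<Rightarrow> real" where
  "ls_estimate N T x u =
     (ARG_MIN (\<lambda>a'. \<Sum>i=1..N. (x i (T + 1) - a' * x i T - u i T)\<^sup>2) a'. True)"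

lemma ls_estimate_eq_ratio:
  assumes "(\<Sum>i=1..N. (x i T)\<^sup>2) \<noteq> 0"
  shows "ls_estimate N T x u =
    (\<Sum>i=1..N. x i T * (x i (T + 1) - u i T)) / (\<Sum>i=1..N. (x i T)\<^sup>2)"
proof -
  define S where "S = (\<Sum>i=1..N. (x i T)\<^sup>2)"
  define B where "B = (\<Sum>i=1..N. x i T * (x i (T + 1) - u i T))"
  define C where "C = (\<Sum>i=1..N. (x i (T + 1) - u i T)\<^sup>2)"
  define f where "f = (\<lambda>a'. \<Sum>i=1..N. (x i (T + 1) - a' * x i T - u i T)\<^sup>2)"
  have "S \<ge> 0" unfolding S_def by (intro sum_nonneg) simp
  with assms have S: "S > 0" by (simp add: S_def)
  have f: "f b = S * (b - B / S)\<^sup>2 + (C - B\<^sup>2 / S)" for b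
  proof -
    have "f b = (\<Sum>i=1..N. (x i (T + 1) - u i T)\<^sup>2 - 2 * b * (x i T * (x i (T + 1) - u i T))
        + b\<^sup>2 * (x i T)\<^sup>2)"
      unfolding f_def by (intro sum.cong refl) (simp add: power2_eq_square algebra_simps)
    also have "\<dots> = C - 2 * b * B + b\<^sup>2 * S"
      by (simp add: sum.distrib sum_subtractf sum_distrib_left B_def C_def S_def)
    also have "\<dots> = S * (b - B / S)\<^sup>2 + (C - B\<^sup>2 / S)"
      using S by (simp add: field_simps power2_eq_square)
    finally show ?thesis .
  qed
  have min: "f (B / S) < f b" if "b \<noteq> B / S" for b
    using S that by (simp add: f)
  have "is_arg_min f (\<lambda>_. True) = (\<lambda>b. b = B / S)"
    unfolding is_arg_min_def using min by (metis less_asym)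
  then have "ls_estimate N T x u = B / S"
    unfolding ls_estimate_def f_def[symmetric] arg_min_def by simp
  then show ?thesis by (simp add: B_def S_def)
qed

end

theory Submission
  imports Defs
begin

text \<open>
  Write \<open>S\<close> for the sum of the squared \<open>x i T\<close> and \<open>V\<close> for the sum of the \<open>x i T * w i T\<close>. For
  \<open>c > 0\<close>, outside the events \<open>c\<^sup>2 * S \<le> c * V\<close> and \<open>c\<^sup>2 * S \<le> - c * V\<close> one has \<open>S > 0\<close> and
  \<open>\<bar>V / S\<bar> < c\<close>. Each event is bounded by Markov's inequality for \<open>exp ((\<plusminus>c * V - c\<^sup>2 * S) / \<sigma>w\<^sup>2)\<close>.
  Its expectation factors over the experiments, and integrating out first \<open>w i T\<close> and then \<open>x i T\<close>
  gives exactly \<open>(1 + c\<^sup>2 * \<sigma>x\<^sup>2 / \<sigma>w\<^sup>2) powr (- N / 2)\<close>, so no separate lower-tail bound on \<open>S\<close> is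
  needed. For the stated \<open>c\<close>, \<open>y = c\<^sup>2 * \<sigma>x\<^sup>2 / \<sigma>w\<^sup>2 = 16 * ln (4 / \<delta>) / N\<close> is at most \<open>1\<close> by the
  sample size assumption, and \<open>1 + y \<ge> exp (y / 2)\<close> makes each bound at most \<open>\<delta> / 2\<close>.
\<close>

section \<open>Gaussian integrals\<close>

lemma nn_integral_normal_density:
  assumes "0 < \<sigma>"
  shows "(\<integral>\<^sup>+x. ennreal (normal_density \<mu> \<sigma> x) \<partial>lborel) = 1"
  using assms by (simp add: nn_integral_eq_integral)

text \<open>Completing the square: tilting the centred density by \<open>exp (s * x)\<close> shifts
  its mean to \<open>s * \<sigma>\<^sup>2\<close> and leaves only a constant factor.\<close>

lemma nn_integral_normal_density_exp:
  assumes "0 < \<sigma>"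
  shows "(\<integral>\<^sup>+x. ennreal (normal_density 0 \<sigma> x) * ennreal (exp (s * x)) \<partial>lborel)
    = ennreal (exp (s\<^sup>2 * \<sigma>\<^sup>2 / 2))"
proof -
  have "normal_density 0 \<sigma> x * exp (s * x)
      = exp (s\<^sup>2 * \<sigma>\<^sup>2 / 2) * normal_density (s * \<sigma>\<^sup>2) \<sigma> x" for x
  proof -
    have "- x\<^sup>2 / (2 * \<sigma>\<^sup>2) + s * x = s\<^sup>2 * \<sigma>\<^sup>2 / 2 + - (x - s * \<sigma>\<^sup>2)\<^sup>2 / (2 * \<sigma>\<^sup>2)"
      using assms by (simp add: field_simps power2_eq_square)
    then have "exp (- x\<^sup>2 / (2 * \<sigma>\<^sup>2)) * exp (s * x)
        = exp (s\<^sup>2 * \<sigma>\<^sup>2 / 2) * exp (- (x - s * \<sigma>\<^sup>2)\<^sup>2 / (2 * \<sigma>\<^sup>2))"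
      by (simp only: exp_add[symmetric])
    then show ?thesis by (simp add: normal_density_def)
  qed
  then show ?thesis
    using nn_integral_normal_density[OF assms]
    by (simp add: ennreal_mult'[symmetric] nn_integral_cmult)
      (simp add: ennreal_mult' nn_integral_cmult)
qed

text \<open>The damped density is again a centred Gaussian, with variance divided by
  \<open>1 + k * \<sigma>\<^sup>2\<close>; the value is the ratio of the two normalizing
  constants.\<close>

lemma nn_integral_normal_density_exp_neg_square:
  assumes "0 < \<sigma>" "0 \<le> k"
  shows "(\<integral>\<^sup>+x. ennreal (normal_density 0 \<sigma> x) * ennreal (exp (- (k * x\<^sup>2 / 2))) \<partial>lborel)
    = ennreal (1 / sqrt (1 + k * \<sigma>\<^sup>2))"
proof -
  define r where "r = 1 + k * \<sigma>\<^sup>2"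
  have r: "r > 0" using assms by (simp add: r_def add_pos_nonneg)
  have "normal_density 0 \<sigma> x * exp (- (k * x\<^sup>2 / 2))
      = 1 / sqrt r * normal_density 0 (\<sigma> / sqrt r) x" for x
  proof -
    have "- x\<^sup>2 / (2 * \<sigma>\<^sup>2) + - (k * x\<^sup>2 / 2) = - x\<^sup>2 / (2 * (\<sigma> / sqrt r)\<^sup>2)"
      using assms r by (simp add: power_divide) (simp add: r_def field_simps)
    then have "exp (- x\<^sup>2 / (2 * \<sigma>\<^sup>2)) * exp (- (k * x\<^sup>2 / 2))
        = exp (- x\<^sup>2 / (2 * (\<sigma> / sqrt r)\<^sup>2))"
      by (simp only: exp_add[symmetric])
    moreover have "1 / sqrt (2 * pi * \<sigma>\<^sup>2) = 1 / sqrt r * (1 / sqrt (2 * pi * (\<sigma> / sqrt r)\<^sup>2))"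
      using assms r by (simp add: power_divide real_sqrt_mult real_sqrt_divide)
    ultimately show ?thesis by (simp add: normal_density_def)
  qed
  then show ?thesis
    using nn_integral_normal_density[of "\<sigma> / sqrt r" 0] assms r
    unfolding r_def[symmetric]
    by (simp only: ennreal_mult'[symmetric] normal_density_nonneg)
      (simp add: ennreal_mult' nn_integral_cmult del: times_divide_eq_left)
qed

section \<open>Exponential moments, the self-normalized tail and Gaussian sums\<close>

context prob_space
begin

text \<open>Independence makes the joint law a product measure, so Tonelli applies. This allows the
  noise to be integrated out at a fixed state.\<close>

lemma nn_integral_indep_var:
  assumes "indep_var S X T Y" and [measurable]: "f \<in> borel_measurable (S \<Otimes>\<^sub>M T)"
  shows "(\<integral>\<^sup>+\<omega>. f (X \<omega>, Y \<omega>) \<partial>M) = (\<integral>\<^sup>+x. \<integral>\<^sup>+y. f (x, y) \<partial>distr M T Y \<partial>distr M S X)"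
proof -
  have [measurable]: "random_variable S X" "random_variable T Y"
    using assms(1) by (auto dest: indep_var_rv1 indep_var_rv2)
  interpret Y: prob_space "distr M T Y" by (rule prob_space_distr) measurable
  have "(\<integral>\<^sup>+\<omega>. f (X \<omega>, Y \<omega>) \<partial>M) = (\<integral>\<^sup>+z. f z \<partial>distr M (S \<Otimes>\<^sub>M T) (\<lambda>\<omega>. (X \<omega>, Y \<omega>)))"
    by (simp add: nn_integral_distr)
  also have "\<dots> = (\<integral>\<^sup>+z. f z \<partial>(distr M S X \<Otimes>\<^sub>M distr M T Y))"
    using assms(1) by (simp add: indep_var_distribution_eq)
  also have "\<dots> = (\<integral>\<^sup>+x. \<integral>\<^sup>+y. f (x, y) \<partial>distr M T Y \<partial>distr M S X)"
    by (rule Y.nn_integral_fst[symmetric]) simp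
  finally show ?thesis .
qed

text \<open>At a fixed state \<open>x\<close>, integrating out the noise produces
  \<open>exp (c\<^sup>2 * x\<^sup>2 / (2 * \<sigma>\<^sup>2))\<close>, which cancels exactly half of
  the quadratic penalty. The other half is the Gaussian damping in \<open>x\<close>.\<close>

lemma nn_integral_exp_normal_product:
  assumes "indep_var borel X borel W" and pos: "0 < s" "0 < \<sigma>"
    and X: "distributed M lborel X (normal_density 0 s)"
    and W: "distributed M lborel W (normal_density 0 \<sigma>)"
  shows "(\<integral>\<^sup>+\<omega>. ennreal (exp ((c * (X \<omega> * W \<omega>) - c\<^sup>2 * (X \<omega>)\<^sup>2) / \<sigma>\<^sup>2)) \<partial>M)
    = ennreal (1 / sqrt (1 + c\<^sup>2 * s\<^sup>2 / \<sigma>\<^sup>2))"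
proof -
  have D: "distr M borel Y = density lborel f" if "distributed M lborel Y f" for Y f
    using distributed_distr_eq_density[OF that] by (simp cong: distr_cong)
  have "(\<integral>\<^sup>+\<omega>. ennreal (exp ((c * (X \<omega> * W \<omega>) - c\<^sup>2 * (X \<omega>)\<^sup>2) / \<sigma>\<^sup>2)) \<partial>M)
      = (\<integral>\<^sup>+x. \<integral>\<^sup>+y. ennreal (exp ((c * (x * y) - c\<^sup>2 * x\<^sup>2) / \<sigma>\<^sup>2)) \<partial>distr M borel W \<partial>distr M borel X)"
    using nn_integral_indep_var[OF assms(1),
        of "\<lambda>(x, y). ennreal (exp ((c * (x * y) - c\<^sup>2 * x\<^sup>2) / \<sigma>\<^sup>2))"] by simp
  also have "\<dots> = (\<integral>\<^sup>+x. ennreal (exp (- (c\<^sup>2 / \<sigma>\<^sup>2 * x\<^sup>2 / 2))) \<partial>distr M borel X)"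
  proof (rule nn_integral_cong)
    fix x
    have "ennreal (exp ((c * (x * y) - c\<^sup>2 * x\<^sup>2) / \<sigma>\<^sup>2))
        = ennreal (exp (- (c\<^sup>2 * x\<^sup>2 / \<sigma>\<^sup>2))) * ennreal (exp (c * x / \<sigma>\<^sup>2 * y))" for y
      by (simp add: ennreal_mult'[symmetric] exp_add[symmetric] diff_divide_distrib mult.assoc)
    then have "(\<integral>\<^sup>+y. ennreal (exp ((c * (x * y) - c\<^sup>2 * x\<^sup>2) / \<sigma>\<^sup>2)) \<partial>distr M borel W)
        = ennreal (exp (- (c\<^sup>2 * x\<^sup>2 / \<sigma>\<^sup>2))) * ennreal (exp ((c * x / \<sigma>\<^sup>2)\<^sup>2 * \<sigma>\<^sup>2 / 2))"
      by (simp add: D[OF W] nn_integral_cmult nn_integral_density del: times_divide_eq_left)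
        (simp only: nn_integral_normal_density_exp[OF pos(2)])
    also have "\<dots> = ennreal (exp (- (c\<^sup>2 / \<sigma>\<^sup>2 * x\<^sup>2 / 2)))"
      using pos
      by (simp add: ennreal_mult'[symmetric] exp_add[symmetric] field_simps power2_eq_square)
    finally show "(\<integral>\<^sup>+y. ennreal (exp ((c * (x * y) - c\<^sup>2 * x\<^sup>2) / \<sigma>\<^sup>2)) \<partial>distr M borel W)
        = ennreal (exp (- (c\<^sup>2 / \<sigma>\<^sup>2 * x\<^sup>2 / 2)))" .
  qed
  also have "\<dots> = ennreal (1 / sqrt (1 + c\<^sup>2 / \<sigma>\<^sup>2 * s\<^sup>2))"
    by (simp only: D[OF X]) (subst nn_integral_density,
      simp_all only: nn_integral_normal_density_exp_neg_square[OF pos(1), of "c\<^sup>2 / \<sigma>\<^sup>2"] divide_nonneg_nonneg zero_le_power2, simp_all)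
  finally show ?thesis by simp
qed

text \<open>The sign of \<open>c\<close> is left free and the bound depends only on its square, so
  \<open>c\<close> and \<open>-c\<close> give the two tails.\<close>

lemma self_normalized_normal_tail:
  assumes I: "finite I" and pos: "0 < s" "0 < \<sigma>"
    and ind: "indep_vars (\<lambda>_. borel \<Otimes>\<^sub>M borel) (\<lambda>i \<omega>. (X i \<omega>, W i \<omega>)) I"
    and XW: "\<And>i. i \<in> I \<Longrightarrow> indep_var borel (X i) borel (W i)"
    and X: "\<And>i. i \<in> I \<Longrightarrow> distributed M lborel (X i) (normal_density 0 s)"
    and W: "\<And>i. i \<in> I \<Longrightarrow> distributed M lborel (W i) (normal_density 0 \<sigma>)"
  shows "prob {\<omega> \<in> space M. c\<^sup>2 * (\<Sum>i\<in>I. (X i \<omega>)\<^sup>2) \<le> c * (\<Sum>i\<in>I. X i \<omega> * W i \<omega>)}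
    \<le> (1 / sqrt (1 + c\<^sup>2 * s\<^sup>2 / \<sigma>\<^sup>2)) ^ card I"
proof -
  define g where "g i \<omega> = exp ((c * (X i \<omega> * W i \<omega>) - c\<^sup>2 * (X i \<omega>)\<^sup>2) / \<sigma>\<^sup>2)" for i \<omega>
  have [measurable]: "random_variable borel (X i)" "random_variable borel (W i)" if "i \<in> I" for i
    using XW[OF that] by (auto dest: indep_var_rv1 indep_var_rv2)
  have indg: "indep_vars (\<lambda>_. borel) (\<lambda>i \<omega>. ennreal (g i \<omega>)) I"
    using indep_vars_compose2[OF ind, of
        "\<lambda>i (x, y). ennreal (exp ((c * (x * y) - c\<^sup>2 * x\<^sup>2) / \<sigma>\<^sup>2))" "\<lambda>_. borel"]
    by (simp add: g_def)
  have g: "0 \<le> g i \<omega>" for i \<omega> by (simp add: g_def)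
  \<comment> \<open>The product is the exponential of the difference of the two sides divided by
    \<open>\<sigma>\<^sup>2\<close>, so Markov's inequality applies at threshold 1.\<close>
  have "1 \<le> (\<Prod>i\<in>I. g i \<omega>) \<longleftrightarrow> c\<^sup>2 * (\<Sum>i\<in>I. (X i \<omega>)\<^sup>2) \<le> c * (\<Sum>i\<in>I. X i \<omega> * W i \<omega>)" for \<omega>
    using pos I by (simp add: g_def exp_sum[symmetric] sum_divide_distrib[symmetric]
        sum_subtractf sum_distrib_left[symmetric] zero_le_divide_iff)
  then have "emeasure M {\<omega> \<in> space M. c\<^sup>2 * (\<Sum>i\<in>I. (X i \<omega>)\<^sup>2) \<le> c * (\<Sum>i\<in>I. X i \<omega> * W i \<omega>)}
      = emeasure M {\<omega> \<in> space M. 1 \<le> 1 * (\<Prod>i\<in>I. ennreal (g i \<omega>))}"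
    by (simp add: prod_ennreal g prod_nonneg)
  also have "\<dots> \<le> 1 * (\<integral>\<^sup>+\<omega>. (\<Prod>i\<in>I. ennreal (g i \<omega>)) * indicator (space M) \<omega> \<partial>M)"
    by (rule nn_integral_Markov_inequality) (simp_all add: g_def)
  also have "\<dots> = (\<integral>\<^sup>+\<omega>. (\<Prod>i\<in>I. ennreal (g i \<omega>)) \<partial>M)"
    by (auto intro!: nn_integral_cong)
  also have "\<dots> = (\<Prod>i\<in>I. \<integral>\<^sup>+\<omega>. ennreal (g i \<omega>) \<partial>M)"
    by (rule indep_vars_nn_integral[OF I indg]) simp
  also have "\<dots> = (\<Prod>i\<in>I. ennreal (1 / sqrt (1 + c\<^sup>2 * s\<^sup>2 / \<sigma>\<^sup>2)))"
    unfolding g_def by (intro prod.cong refl nn_integral_exp_normal_product XW X W pos)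
  also have "\<dots> = ennreal ((1 / sqrt (1 + c\<^sup>2 * s\<^sup>2 / \<sigma>\<^sup>2)) ^ card I)"
    by (simp only: prod_constant) (simp add: ennreal_power)
  finally show ?thesis
    by (simp add: emeasure_eq_measure ennreal_le_iff)
qed

text \<open>
  Zero coefficients are allowed: for \<open>a = 0\<close> only the last noise terms contribute to the state.
\<close>

lemma distributed_normal_weighted_sum:
  assumes "finite I" "indep_vars (\<lambda>_. borel) X I"
    and "\<And>i. i \<in> I \<Longrightarrow> 0 < \<sigma> i"
    and "\<And>i. i \<in> I \<Longrightarrow> distributed M lborel (X i) (normal_density 0 (\<sigma> i))"
    and "\<exists>i\<in>I. c i \<noteq> 0"
  shows "distributed M lborel (\<lambda>\<omega>. \<Sum>i\<in>I. c i * X i \<omega>)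
    (normal_density 0 (sqrt (\<Sum>i\<in>I. (c i * \<sigma> i)\<^sup>2)))"
proof -
  \<comment> \<open>A term with coefficient zero is constant and has no density, so it is dropped
    before \<open>sum_indep_normal\<close> is applied; the last hypothesis keeps \<open>J\<close>
    nonempty.\<close>
  define J where "J = {i \<in> I. c i \<noteq> 0}"
  have "indep_vars (\<lambda>_. borel) (\<lambda>i \<omega>. c i * X i \<omega>) J"
    by (rule indep_vars_compose2[where M'="\<lambda>_. borel"])
      (auto intro: indep_vars_subset[OF assms(2)] simp: J_def)
  moreover have "distributed M lborel (\<lambda>\<omega>. c i * X i \<omega>) (normal_density 0 (\<bar>c i\<bar> * \<sigma> i))"
    if "i \<in> J" for i
    using normal_density_affine[OF assms(4,3), of i "c i" 0] that by (simp add: J_def)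
  ultimately have "distributed M lborel (\<lambda>\<omega>. \<Sum>i\<in>J. c i * X i \<omega>)
      (normal_density (\<Sum>i\<in>J. 0) (sqrt (\<Sum>i\<in>J. (\<bar>c i\<bar> * \<sigma> i)\<^sup>2)))"
    using assms by (intro sum_indep_normal) (auto simp: J_def)
  moreover have "(\<Sum>i\<in>J. (\<bar>c i\<bar> * \<sigma> i)\<^sup>2) = (\<Sum>i\<in>I. (c i * \<sigma> i)\<^sup>2)"
    using assms(1) by (intro sum.mono_neutral_cong_left) (auto simp: J_def power_mult_distrib)
  moreover have "(\<Sum>i\<in>J. c i * X i \<omega>) = (\<Sum>i\<in>I. c i * X i \<omega>)" for \<omega>
    using assms(1) by (intro sum.mono_neutral_left) (auto simp: J_def)
  ultimately show ?thesis by simp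
qed

end

section \<open>Numerical consequences of the sample size condition\<close>

text \<open>The quadratic bound on exp gives 1 + y/2 + y^2/4, which is at most 1 + 3y/4 because y^2
  \<le> y.\<close>

lemma exp_half_le_one_plus:
  fixes y :: real
  assumes "0 \<le> y" "y \<le> 1"
  shows "exp (y / 2) \<le> 1 + y"
proof -
  have "exp (y / 2) \<le> 1 + y / 2 + (y / 2)\<^sup>2"
    using assms by (intro exp_bound) auto
  moreover have "y\<^sup>2 \<le> y" using assms by (simp add: power2_eq_square mult_left_le)
  ultimately show ?thesis using assms by (simp add: power_divide)
qed

lemma sample_size_bound:
  fixes \<delta> :: real
  assumes "0 < \<delta>" "\<delta> \<le> 1" "32 * ln (2 / \<delta>) \<le> real N"
  shows "(1 / sqrt (1 + 16 * ln (4 / \<delta>) / real N)) ^ N \<le> \<delta> / 2"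
proof -
  define y where "y = 16 * ln (4 / \<delta>) / real N"
  \<comment> \<open>Since \<delta> \<le> 1, ln (4/\<delta>) is at most 2 ln (2/\<delta>). The
    constant 32 therefore yields 16 ln (4/\<delta>) \<le> N, that is, y \<le> 1.\<close>
  have l: "ln (4 / \<delta>) = ln 2 + ln (2 / \<delta>)" "ln 2 \<le> ln (2 / \<delta>)" "0 < ln (2::real)"
    using assms by (simp_all add: ln_div ln_mult[of 2 2, simplified])
  then have N: "0 < real N" using assms by linarith
  have "16 * ln (4 / \<delta>) \<le> real N" using l assms(3) by linarith
  moreover have "0 \<le> ln (4 / \<delta>)" using l by linarith
  ultimately have y: "0 \<le> y" "y \<le> 1" using N by (simp_all add: y_def)
  have "exp (y / 4) = sqrt (exp (y / 2))"
    by (rule real_sqrt_unique[symmetric]) (simp_all add: power2_eq_square exp_add[symmetric])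
  also have "\<dots> \<le> sqrt (1 + y)" using exp_half_le_one_plus[OF y] by simp
  finally have "1 / sqrt (1 + y) \<le> exp (- (y / 4))"
    using y by (simp add: exp_minus field_simps)
  then have "(1 / sqrt (1 + y)) ^ N \<le> exp (- (y / 4)) ^ N"
    using y by (intro power_mono) auto
  \<comment> \<open>This equals (\<delta>/4)^4, well below the required \<delta>/2.\<close>
  also have "\<dots> = exp (- (4 * ln (4 / \<delta>)))"
    using N by (simp add: exp_of_nat_mult[symmetric] y_def)
  also have "\<dots> \<le> exp (- ln (2 / \<delta>))"
    unfolding exp_le_cancel_iff using l by linarith
  also have "\<dots> = \<delta> / 2" using assms by (simp add: exp_minus)
  finally show ?thesis by (simp add: y_def)
qed

section \<open>The least-squares estimate and the state recursion\<close>

text \<open>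
  On the null event that all \<open>x i T\<close> vanish the estimate is a fixed junk value, which is what makes
  the event of the theorem measurable.
\<close>

lemma ls_estimate_eq_default:
  assumes "(\<Sum>i=1..N. (x i T)\<^sup>2) = 0"
  shows "ls_estimate N T x u = (SOME b. True)"
proof -
  have "x i T = 0" if "i \<in> {1..N}" for i
    using assms that by (simp add: sum_nonneg_eq_0_iff)
  then have "(\<Sum>i=1..N. (x i (T + 1) - b * x i T - u i T)\<^sup>2)
      = (\<Sum>i=1..N. (x i (T + 1) - u i T)\<^sup>2)" for b
    by (intro sum.cong) auto
  then show ?thesis
    unfolding ls_estimate_def arg_min_def is_arg_min_def by (simp only:) simp
qed

text \<open>Inserting the last transition splits the numerator of the ratio into \<open>a\<close>
  times the denominator plus the noise term.\<close>

lemma ls_estimate_eq: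
  assumes "\<And>i. i \<in> {1..N} \<Longrightarrow> x i (T + 1) = a * x i T + u i T + w i"
  shows "ls_estimate N T x u = (if (\<Sum>i=1..N. (x i T)\<^sup>2) = 0 then (SOME b. True)
    else a + (\<Sum>i=1..N. x i T * w i) / (\<Sum>i=1..N. (x i T)\<^sup>2))"
proof -
  have "(\<Sum>i=1..N. x i T * (x i (T + 1) - u i T))
      = (\<Sum>i=1..N. a * (x i T)\<^sup>2 + x i T * w i)"
    using assms by (intro sum.cong) (simp_all add: power2_eq_square algebra_simps)
  also have "\<dots> = a * (\<Sum>i=1..N. (x i T)\<^sup>2) + (\<Sum>i=1..N. x i T * w i)"
    by (simp add: sum.distrib sum_distrib_left)
  finally show ?thesis
    using ls_estimate_eq_ratio[of x T N u] ls_estimate_eq_default[of x T N u]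
    by (simp add: add_divide_distrib)
qed

text \<open>The input at time \<open>s\<close> is multiplied by \<open>a\<close> once in each of the
  \<open>n - 1 - s\<close> later steps.\<close>

lemma linear_recursion_eq_sum:
  fixes z v :: "nat \<Rightarrow> real"
  assumes "z 0 = 0" "\<And>t. t < n \<Longrightarrow> z (Suc t) = a * z t + v t"
  shows "z n = (\<Sum>s<n. a ^ (n - 1 - s) * v s)"
  using assms(2)
proof (induction n)
  case (Suc n)
  have "(\<Sum>s<n. a ^ (n - s) * v s) = (\<Sum>s<n. a * (a ^ (n - 1 - s) * v s))"
  proof (rule sum.cong)
    fix s assume "s \<in> {..<n}"
    then have "n - s = Suc (n - 1 - s)" by auto
    then show "a ^ (n - s) * v s = a * (a ^ (n - 1 - s) * v s)" by simp
  qed simp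
  with Suc show ?case by (simp add: sum_distrib_left)
qed (simp add: assms(1))

theorem theorem3:
  fixes M :: "'a measure"
    and a \<sigma>w \<sigma>u \<sigma>x \<delta> :: real
    and T N :: nat
    and x u w :: "nat \<Rightarrow> nat \<Rightarrow> 'a \<Rightarrow> real"
  assumes "prob_space M"
    and "\<sigma>w > 0" and "\<sigma>u > 0" and "T \<ge> 1"
    and "\<And>i t. i \<in> {1..N} \<Longrightarrow> t \<in> {0..T} \<Longrightarrow>
           distributed M lborel (w i t) (normal_density 0 \<sigma>w)"
    and "\<And>i t. i \<in> {1..N} \<Longrightarrow> t \<in> {0..T} \<Longrightarrow>
           distributed M lborel (u i t) (normal_density 0 \<sigma>u)"
    and "prob_space.indep_vars M (\<lambda>_. borel)
           (case_sum (\<lambda>(i, t). w i t) (\<lambda>(i, t). u i t))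
           (({1..N} \<times> {0..T}) <+> ({1..N} \<times> {0..T}))"
    and "\<And>i \<omega>. i \<in> {1..N} \<Longrightarrow> \<omega> \<in> space M \<Longrightarrow> x i 0 \<omega> = 0"
    and "\<And>i t \<omega>. i \<in> {1..N} \<Longrightarrow> t \<in> {0..T} \<Longrightarrow> \<omega> \<in> space M \<Longrightarrow>
           x i (t + 1) \<omega> = a * x i t \<omega> + u i t \<omega> + w i t \<omega>"
    and "\<sigma>x > 0" and "\<sigma>x\<^sup>2 = (\<sigma>w\<^sup>2 + \<sigma>u\<^sup>2) * (\<Sum>t=0..T-1. a ^ (2 * t))"
    and "0 < \<delta>" and "\<delta> \<le> 1"
    and "real N \<ge> 32 * ln (2 / \<delta>)"
  shows "measure M {\<omega> \<in> space M.
           \<bar>ls_estimate N T (\<lambda>i t. x i t \<omega>) (\<lambda>i t. u i t \<omega>) - a\<bar>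
             \<le> 4 * (\<sigma>w / \<sigma>x) * sqrt (ln (4 / \<delta>) / real N)} \<ge> 1 - \<delta>"
proof -
  interpret prob_space M by fact
  define Z where "Z = case_sum (\<lambda>(i, t). w i t) (\<lambda>(i, t). u i t)"
  \<comment> \<open>\<open>P i\<close> indexes the disturbances of experiment \<open>i\<close>
    before time \<open>T\<close>, the only ones that enter its state at time \<open>T\<close>;
    \<open>K i\<close> below also contains time \<open>T\<close>.\<close>
  define P where "P i = Pair i ` {..<T} <+> Pair i ` {..<T}" for i :: nat
  define h :: "nat \<times> nat + nat \<times> nat \<Rightarrow> real"
    where "h = case_sum (\<lambda>(i, s). a ^ (T - 1 - s)) (\<lambda>(i, s). a ^ (T - 1 - s))"
  \<comment> \<open>A fixed linear function of the disturbances, from which law and independence are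
    read off; it agrees with \<open>x i T\<close> on \<open>space M\<close>.\<close>
  define X where "X i \<omega> = (\<Sum>k\<in>P i. h k * Z k \<omega>)" for i \<omega>
  define W where "W i = w i T" for i
  define K where "K i = Pair i ` {0..T} <+> Pair i ` {0..T}" for i :: nat
  let ?A = "({1..N} \<times> {0..T}) <+> ({1..N} \<times> {0..T})"
  have indZ: "indep_vars (\<lambda>_. borel) Z ?A"
    unfolding Z_def by fact
  have PK: "P i \<subseteq> K i" "Inl (i, T) \<in> K i" "Inl (i, T) \<notin> P i" for i
    by (auto simp: P_def K_def)
  have KA: "K i \<subseteq> ?A" if "i \<in> {1..N}" for i
    using that by (auto simp: K_def)
  have sum_P: "(\<Sum>k\<in>P i. f k) = (\<Sum>s<T. f (Inl (i, s)) + f (Inr (i, s)))"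
    for i and f :: "nat \<times> nat + nat \<times> nat \<Rightarrow> real"
    unfolding P_def
    by (simp add: sum.Plus sum.reindex inj_on_def sum.distrib)
  have xX: "x i T \<omega> = X i \<omega>" if "i \<in> {1..N}" "\<omega> \<in> space M" for i \<omega>
  proof -
    have "x i T \<omega> = (\<Sum>s<T. a ^ (T - 1 - s) * (u i s \<omega> + w i s \<omega>))"
    proof (rule linear_recursion_eq_sum)
      show "x i 0 \<omega> = 0" using assms(8) that by simp
      show "x i (Suc t) \<omega> = a * x i t \<omega> + (u i t \<omega> + w i t \<omega>)" if "t < T" for t
        using assms(9)[of i t \<omega>] that \<open>i \<in> {1..N}\<close> \<open>\<omega> \<in> space M\<close> by simp
    qed
    then show ?thesis
      by (simp add: X_def sum_P h_def Z_def algebra_simps)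
  qed
  have distW: "distributed M lborel (W i) (normal_density 0 \<sigma>w)" if "i \<in> {1..N}" for i
    using assms(5) that by (simp add: W_def)
  have distX: "distributed M lborel (X i) (normal_density 0 \<sigma>x)" if "i \<in> {1..N}" for i
  proof -
    define \<sigma> :: "nat \<times> nat + nat \<times> nat \<Rightarrow> real" where "\<sigma> = case_sum (\<lambda>_. \<sigma>w) (\<lambda>_. \<sigma>u)"
    have "distributed M lborel (\<lambda>\<omega>. \<Sum>k\<in>P i. h k * Z k \<omega>)
        (normal_density 0 (sqrt (\<Sum>k\<in>P i. (h k * \<sigma> k)\<^sup>2)))"
    proof (rule distributed_normal_weighted_sum)
      show "indep_vars (\<lambda>_. borel) Z (P i)"
        using PK KA that by (intro indep_vars_subset[OF indZ]) blast
      \<comment> \<open>The latest noise before time \<open>T\<close> has coefficient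
        \<open>a ^ 0 = 1\<close>, nonzero even for \<open>a = 0\<close>.\<close>
      show "\<exists>k\<in>P i. h k \<noteq> 0"
        using assms(4) by (intro bexI[of _ "Inl (i, T - 1)"]) (auto simp: h_def P_def)
    qed (use assms(2,3,5,6) that in \<open>auto simp: P_def \<sigma>_def Z_def\<close>)
    moreover have "(\<Sum>k\<in>P i. (h k * \<sigma> k)\<^sup>2) = \<sigma>x\<^sup>2"
    proof -
      have "(\<Sum>k\<in>P i. (h k * \<sigma> k)\<^sup>2) = (\<sigma>w\<^sup>2 + \<sigma>u\<^sup>2) * (\<Sum>s<T. a ^ (2 * (T - Suc s)))"
        by (simp add: sum_P h_def \<sigma>_def sum_distrib_left power_mult_distrib power_mult[symmetric]
            algebra_simps)
      also have "(\<Sum>s<T. a ^ (2 * (T - Suc s))) = (\<Sum>s<T. a ^ (2 * s))"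
        by (rule sum.nat_diff_reindex)
      also have "{..<T} = {0..T - 1}" using assms(4) by auto
      finally show ?thesis using assms(11) by simp
    qed
    ultimately show ?thesis using assms(10) by (simp add: X_def[abs_def])
  qed
  have indXW: "indep_var borel (X i) borel (W i)" if "i \<in> {1..N}" for i
  proof -
    \<comment> \<open>The state and the last noise depend on disjoint sets of indices.\<close>
    have "indep_var (PiM (P i) (\<lambda>_. borel)) (\<lambda>\<omega>. restrict (\<lambda>k. Z k \<omega>) (P i))
        (PiM {Inl (i, T)} (\<lambda>_. borel)) (\<lambda>\<omega>. restrict (\<lambda>k. Z k \<omega>) {Inl (i, T)})"
      using PK[of i] KA[OF that] by (intro indep_var_restrict[OF indZ]) auto
    then have "indep_var borel ((\<lambda>f. \<Sum>k\<in>P i. h k * f k) \<circ> (\<lambda>\<omega>. restrict (\<lambda>k. Z k \<omega>) (P i)))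
        borel ((\<lambda>f. f (Inl (i, T))) \<circ> (\<lambda>\<omega>. restrict (\<lambda>k. Z k \<omega>) {Inl (i, T)}))"
      by (rule indep_var_compose) measurable
    then show ?thesis
      by (simp add: comp_def X_def[abs_def] W_def Z_def)
  qed
  have ind_pairs: "indep_vars (\<lambda>_. borel \<Otimes>\<^sub>M borel) (\<lambda>i \<omega>. (X i \<omega>, W i \<omega>)) {1..N}"
  proof -
    \<comment> \<open>Different experiments use disjoint blocks \<open>K i\<close>, and each pair is
      a measurable function of its own block.\<close>
    have "indep_vars (\<lambda>i. PiM (K i) (\<lambda>_. borel)) (\<lambda>i \<omega>. restrict (\<lambda>k. Z k \<omega>) (K i)) {1..N}"
      by (rule indep_vars_restrict[OF indZ KA]) (auto simp: disjoint_family_on_def K_def)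
    then have "indep_vars (\<lambda>_. borel \<Otimes>\<^sub>M borel) (\<lambda>i \<omega>. (\<lambda>f. (\<Sum>k\<in>P i. h k * f k, f (Inl (i, T))))
        (restrict (\<lambda>k. Z k \<omega>) (K i))) {1..N}"
    proof (rule indep_vars_compose2)
      fix i
      have [measurable]: "(\<lambda>f. f k) \<in> borel_measurable (PiM (K i) (\<lambda>_. borel))"
        if "k \<in> P i \<or> k = Inl (i, T)" for k
        using that PK[of i] by (intro measurable_component_singleton) auto
      show "(\<lambda>f. (\<Sum>k\<in>P i. h k * f k, f (Inl (i, T)))) \<in> PiM (K i) (\<lambda>_. borel) \<rightarrow>\<^sub>M borel \<Otimes>\<^sub>M borel"
        by measurable
    qed
    moreover have "(\<Sum>k\<in>P i. h k * restrict (\<lambda>k. Z k \<omega>) (K i) k) = X i \<omega>" for i \<omega>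
      using PK(1)[of i] unfolding X_def by (intro sum.cong) auto
    ultimately show ?thesis
      by (simp add: PK W_def Z_def)
  qed
  have meas [measurable]: "random_variable borel (X i)" "random_variable borel (W i)"
    if "i \<in> {1..N}" for i
    using indXW[OF that] by (auto dest: indep_var_rv1 indep_var_rv2)

  define S where "S \<omega> = (\<Sum>i=1..N. (X i \<omega>)\<^sup>2)" for \<omega>
  define V where "V \<omega> = (\<Sum>i=1..N. X i \<omega> * W i \<omega>)" for \<omega>
  have [measurable]: "random_variable borel S" "random_variable borel V"
    unfolding S_def[abs_def] V_def[abs_def] by measurable
  define c where "c = 4 * (\<sigma>w / \<sigma>x) * sqrt (ln (4 / \<delta>) / real N)"
  have "0 < ln (2 / \<delta>)" "0 < ln (4 / \<delta>)" using assms(12,13) by simp_all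
  with assms(14) have N: "0 < real N" by linarith
  have c: "0 < c" "c\<^sup>2 * \<sigma>x\<^sup>2 / \<sigma>w\<^sup>2 = 16 * ln (4 / \<delta>) / real N"
    using assms(2,10) N \<open>0 < ln (4 / \<delta>)\<close>
    by (simp_all add: c_def power_mult_distrib power_divide field_simps)
  define B where "B b = {\<omega> \<in> space M. b\<^sup>2 * S \<omega> \<le> b * V \<omega>}" for b
  have [measurable]: "B b \<in> events" for b unfolding B_def by measurable
  have prob_B: "prob (B b) \<le> \<delta> / 2" if "b\<^sup>2 = c\<^sup>2" for b
    using self_normalized_normal_tail[OF _ assms(10,2) ind_pairs indXW distX distW, of b]
      sample_size_bound[OF assms(12,13), of N] assms(14)
    by (simp add: B_def S_def V_def that c)
  let ?G = "{\<omega> \<in> space M.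
    \<bar>ls_estimate N T (\<lambda>i t. x i t \<omega>) (\<lambda>i t. u i t \<omega>) - a\<bar> \<le> c}"
  have ls: "ls_estimate N T (\<lambda>i t. x i t \<omega>) (\<lambda>i t. u i t \<omega>)
      = (if S \<omega> = 0 then (SOME b. True) else a + V \<omega> / S \<omega>)" if "\<omega> \<in> space M" for \<omega>
    using ls_estimate_eq[of N "\<lambda>i t. x i t \<omega>" T a "\<lambda>i t. u i t \<omega>" "\<lambda>i. W i \<omega>"]
      assms(9) that by (simp add: W_def S_def V_def xX)
  have "?G = {\<omega> \<in> space M. \<bar>(if S \<omega> = 0 then (SOME b. True) else a + V \<omega> / S \<omega>) - a\<bar> \<le> c}"
    by (intro Collect_cong conj_cong refl) (simp only: ls)
  also have "\<dots> \<in> events" by measurable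
  finally have G: "?G \<in> events" .
  have "space M - (B c \<union> B (- c)) \<subseteq> ?G"
  proof
    fix \<omega> assume *: "\<omega> \<in> space M - (B c \<union> B (- c))"
    then have lt: "c * V \<omega> < c * (c * S \<omega>)" "c * (- V \<omega>) < c * (c * S \<omega>)"
      by (auto simp: B_def power2_eq_square mult.assoc)
    then have V: "V \<omega> < c * S \<omega>" "- V \<omega> < c * S \<omega>"
      using c(1) by (simp_all only: mult_less_cancel_left_pos)
    \<comment> \<open>Adding the two bounds on \<open>V \<omega>\<close> excludes
      \<open>S \<omega> = 0\<close>, so the default value of the estimate never occurs here.\<close>
    then have "0 < c * S \<omega>" by linarith
    then have S: "0 < S \<omega>" using c(1) by (simp add: zero_less_mult_iff)
    then have "\<bar>V \<omega> / S \<omega>\<bar> \<le> c" using V by (simp add: abs_le_iff field_simps)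
    then show "\<omega> \<in> ?G" using * S by (simp add: ls)
  qed
  then have "prob (space M - (B c \<union> B (- c))) \<le> prob ?G"
    by (rule finite_measure_mono) (rule G)
  moreover have "prob (space M - (B c \<union> B (- c))) = 1 - prob (B c \<union> B (- c))"
    by (rule prob_compl) measurable
  moreover have "prob (B c \<union> B (- c)) \<le> prob (B c) + prob (B (- c))"
    by (rule measure_Un_le) measurable
  ultimately show ?thesis
    using prob_B[of c] prob_B[of "- c"] by (simp add: c_def)
qed

end
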